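(* Let $X$ be a separable metric space. Then $X$ satisfies all tree comparisons (that is, the $T$-tree comparison for every finite tree $T$) if and only if $X$ is isometric to the target space of a submetry defined on a subset of a separable Hilbert space.
   Context: $|a-b|_X$ denotes the distance between $a,b$ in a metric space $X$; $\mathbb{H}$ denotes an infinite-dimensional real Hilbert space. Tree comparison: let $T$ be a finite (combinatorial) tree with $n$ vertices. A point array $(a_1,\dots,a_n)$ in a metric space $X$ labeled by the vertices of $T$ (repetitions of points allowed) satisfies the $T$-tree comparison if there is a point array $(\tilde a_1,\dots,\tilde a_n)$ in $\mathbb{H}$ such that $|\tilde a_i-\tilde a_j|_{\mathbb{H}}\ge |a_i-a_j|_X$ for all $i,j$, with equality whenever $a_i$ and $a_j$ label adjacent vertices of $T$. The metric space $X$ satisfies the $T$-tree comparison if every $n$-point array in $X$ labeled by the vertices of $T$ satisfies it. A map $f\colon W\to X$ between metric spaces is a submetry if $f[B(w,r)_W]=B(f(w),r)_X$ for any $w\in W$ and $r\ge0$, where $B(w,r)_W$ is the open ball with center $w$ and radius $r$ in $W$. Subsets of a Hilbert space carry the restricted metric. *)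

theory Defs
  imports "HOL-Analysis.Analysis"
begin

text \<open>A combinatorial tree is a connected acyclic simple graph; the edge set is a symmetric
  irreflexive relation on the vertices. The list in the last clause is the vertex sequence of a
  cycle, without repetition of the starting vertex. Trees have at least one vertex.\<close>

definition finite_tree :: "'v set \<Rightarrow> 'v rel \<Rightarrow> bool" where
  "finite_tree V E \<longleftrightarrow>
     finite V \<and> V \<noteq> {} \<and> E \<subseteq> V \<times> V \<and> sym E \<and> irrefl E \<and>
     (\<forall>u\<in>V. \<forall>v\<in>V. (u, v) \<in> E\<^sup>*) \<and>
     \<not> (\<exists>c. length c \<ge> 3 \<and> distinct c \<and> successively (\<lambda>u v. (u, v) \<in> E) c \<and> (last c, hd c) \<in> E)"

definition infinite_dimensional :: "'h::real_vector itself \<Rightarrow> bool" where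
  "infinite_dimensional _ \<longleftrightarrow> \<not> (\<exists>B::'h set. finite B \<and> span B = UNIV)"

definition array_tree_comparison ::
  "'h::real_inner itself \<Rightarrow> 'v set \<Rightarrow> 'v rel \<Rightarrow> 'a metric \<Rightarrow> ('v \<Rightarrow> 'a) \<Rightarrow> bool" where
  "array_tree_comparison _ V E X a \<longleftrightarrow>
     (\<exists>b :: 'v \<Rightarrow> 'h.
        (\<forall>i\<in>V. \<forall>j\<in>V. dist (b i) (b j) \<ge> mdist X (a i) (a j)) \<and>
        (\<forall>(i, j)\<in>E. dist (b i) (b j) = mdist X (a i) (a j)))"

definition tree_comparison ::
  "'h::real_inner itself \<Rightarrow> 'v set \<Rightarrow> 'v rel \<Rightarrow> 'a metric \<Rightarrow> bool" where
  "tree_comparison H V E X \<longleftrightarrow> (\<forall>a \<in> V \<rightarrow> mspace X. array_tree_comparison H V E X a)"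

text \<open>Every finite tree is isomorphic to one whose vertices are natural numbers.\<close>

definition all_tree_comparisons :: "'h::real_inner itself \<Rightarrow> 'a metric \<Rightarrow> bool" where
  "all_tree_comparisons H X \<longleftrightarrow>
     (\<forall>(V :: nat set) E. finite_tree V E \<longrightarrow> tree_comparison H V E X)"

text \<open>For nonempty \<open>W\<close> the condition on balls implies that \<open>f\<close> maps \<open>W\<close> onto \<open>Y\<close>. Stating
  this as a separate condition only excludes the map from the empty space to a nonempty one, for
  which the condition on balls is vacuous.\<close>

definition submetry :: "'w metric \<Rightarrow> 'y metric \<Rightarrow> ('w \<Rightarrow> 'y) \<Rightarrow> bool" where
  "submetry W Y f \<longleftrightarrow>
     f ` mspace W = mspace Y \<and>
     (\<forall>w\<in>mspace W. \<forall>r\<ge>0. f ` mball_of W w r = mball_of Y (f w) r)"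

definition isometric_spaces :: "'x metric \<Rightarrow> 'y metric \<Rightarrow> bool" where
  "isometric_spaces X Y \<longleftrightarrow>
     (\<exists>g. bij_betw g (mspace X) (mspace Y) \<and>
          (\<forall>x\<in>mspace X. \<forall>x'\<in>mspace X. mdist Y (g x) (g x') = mdist X x x'))"

definition separable_hilbert_subspace :: "'s::real_inner set \<Rightarrow> bool" where
  "separable_hilbert_subspace L \<longleftrightarrow> subspace L \<and> complete L \<and> separable_space (top_of_set L)"

text \<open>HOL cannot quantify over types, so the separable Hilbert space ranges over the complete
  separable linear subspaces \<open>L\<close> of a Hilbert space \<open>'s\<close>. If \<open>'s\<close> is infinite-dimensional, then
  every separable Hilbert space is isometrically isomorphic to such an \<open>L\<close>. For
  the same reason the target \<open>Y\<close> has its points in the type of those of \<open>X\<close>, which loses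
  nothing because \<open>Y\<close> is isometric to \<open>X\<close>.\<close>

definition isometric_to_submetry_target ::
  "'s::{real_inner, complete_space} itself \<Rightarrow> 'a metric \<Rightarrow> bool" where
  "isometric_to_submetry_target _ X \<longleftrightarrow>
     (\<exists>(L :: 's set) S (Y :: 'a metric) f.
        separable_hilbert_subspace L \<and> S \<subseteq> L \<and>
        submetry (submetric euclidean_metric S) Y f \<and> isometric_spaces X Y)"

end

theory Submission
  imports Defs "HOL-Library.Nat_Bijection"
begin

text \<open>
  From a submetry to tree comparison. Let \<open>f : S \<rightarrow> Y\<close> be a submetry with \<open>S\<close> in a Hilbert space, and
  let the vertices of a finite tree be labeled by points of \<open>Y\<close>. Lift the label of a root to \<open>S\<close> and
  proceed along the edges: since \<open>f\<close> maps balls onto balls, the label of each further vertex has a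
  lift whose distance to the lift of its neighbor exceeds the distance of the labels by at most
  \<open>\<epsilon>\<close>. Because \<open>f\<close> does not increase distances, all distances of the lifts are at least those of
  the labels. The comparison demands exact equality on edges, which a submetry in terms of open
  balls does not give, so \<open>\<epsilon>\<close> must tend to \<open>0\<close> and the lifts must converge.

  From tree comparison to a submetry. Let \<open>q\<close> enumerate a dense subset of \<open>X\<close>, and consider the
  infinite rooted tree in which every vertex has one child labeled \<open>q l\<close> for each \<open>l\<close>. Its
  finite subtrees satisfy the comparison, and a limit of the resulting arrays is an array \<open>b\<close> for
  the whole tree. Since distances in \<open>b\<close> dominate distances of labels, a point of \<open>b\<close> determines
  its label. The map from points of \<open>b\<close> to labels is short, and it lifts every \<open>q l\<close> to exactly
  the right distance, because every vertex has a child labeled \<open>q l\<close>. So it is a submetry onto the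
  dense set. The closure of its graph is the graph of a submetry onto all of \<open>X\<close>: to lift a point
  \<open>y\<close>, walk down the tree along labels that converge to \<open>y\<close> geometrically fast
  (\<open>limit_pair_lift\<close>). Taking the closure inside \<open>X\<close> and the Hilbert space avoids completing \<open>X\<close>.

  Both limits come from \<open>bounded_arrays_subconverge\<close>: a sequence of bounded arrays in Hilbert spaces
  subconverges, up to isometry, to an array in any prescribed infinite-dimensional space. Points
  of a Hilbert space have no compactness of their own, but the first \<open>n\<close> points of an array can be
  moved isometrically so that the \<open>i\<close>-th lies in the span of \<open>i + 1\<close> fixed orthonormal vectors
  (\<open>triangular_realization\<close>), and then their coordinates range over compact intervals. This also moves
  arrays between the two Hilbert spaces of the statement.
\<close>

section \<open>Arrays of points in a Hilbert space up to isometry\<close>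

text \<open>One Gram--Schmidt step: subtract from \<open>x n\<close> its projection onto the previous vectors, and project
  \<open>z\<close> onto the difference \<open>s\<close> as well. Coefficients instead of a point of the span are given because
  \<open>triangular_realization\<close> applies the same coefficients to other vectors.\<close>

lemma orthogonal_projection_onto_finite_span:
  fixes x :: "nat \<Rightarrow> 'a::real_inner"
  shows "\<exists>c. \<forall>j<n. inner (z - (\<Sum>i<n. c i *\<^sub>R x i)) (x j) = 0"
proof (induction n arbitrary: z)
  case 0
  show ?case by simp
next
  case (Suc n)
  obtain c where c: "\<And>j. j < n \<Longrightarrow> inner (z - (\<Sum>i<n. c i *\<^sub>R x i)) (x j) = 0"
    using Suc by blast
  obtain c' where c': "\<And>j. j < n \<Longrightarrow> inner (x n - (\<Sum>i<n. c' i *\<^sub>R x i)) (x j) = 0"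
    using Suc by blast
  define s where "s = x n - (\<Sum>i<n. c' i *\<^sub>R x i)"
  define t where "t = inner z s / inner s s"
  \<comment> \<open>If \<open>s = 0\<close>, then \<open>t = 0\<close>, as division by zero gives zero, and \<open>x n\<close> imposes no new condition.\<close>
  define d where "d = (\<lambda>i. if i < n then c i - t * c' i else t)"
  have s_perp: "inner s (x j) = 0" if "j < n" for j
    using c'[OF that] by (simp add: s_def)
  have "inner s (\<Sum>i<n. a i *\<^sub>R x i) = 0" for a
    by (simp add: inner_sum_right s_perp)
  then have s_perp_sum: "inner (\<Sum>i<n. a i *\<^sub>R x i) s = 0" for a
    by (simp add: inner_commute)
  have "(\<Sum>i<Suc n. d i *\<^sub>R x i) = (\<Sum>i<n. (c i - t * c' i) *\<^sub>R x i) + t *\<^sub>R x n"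
    by (simp add: d_def)
  also have "\<dots> = (\<Sum>i<n. c i *\<^sub>R x i) + t *\<^sub>R s"
    by (simp add: s_def algebra_simps sum_subtractf scaleR_sum_right)
  finally have res: "z - (\<Sum>i<Suc n. d i *\<^sub>R x i) = z - (\<Sum>i<n. c i *\<^sub>R x i) - t *\<^sub>R s"
    by simp
  have small: "inner (z - (\<Sum>i<Suc n. d i *\<^sub>R x i)) (x j) = 0" if "j < n" for j
    using c[OF that] s_perp[OF that] by (simp only: res inner_diff_left) simp
  have "inner (z - (\<Sum>i<Suc n. d i *\<^sub>R x i)) s = 0"
    unfolding res using s_perp_sum[of c]
    by (cases "s = 0") (auto simp: inner_diff_left t_def)
  moreover have "inner (z - (\<Sum>i<Suc n. d i *\<^sub>R x i)) (\<Sum>i<n. c' i *\<^sub>R x i) = 0"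
    by (simp only: inner_sum_right) (simp add: small del: sum.lessThan_Suc)
  moreover have "x n = s + (\<Sum>i<n. c' i *\<^sub>R x i)"
    by (simp add: s_def)
  ultimately have "inner (z - (\<Sum>i<Suc n. d i *\<^sub>R x i)) (x n) = 0"
    by (metis add.right_neutral inner_add_right)
  with small show ?case
    using less_Suc_eq by blast
qed

lemma unit_vector_orthogonal_to_finitely_many:
  fixes x :: "nat \<Rightarrow> 'h::real_inner"
  assumes "infinite_dimensional TYPE('h)"
  shows "\<exists>u. norm u = 1 \<and> (\<forall>j<n. inner u (x j) = 0)"
proof -
  have "span (x ` {..<n}) \<noteq> UNIV"
    using assms unfolding infinite_dimensional_def by blast
  then obtain z where z: "z \<notin> span (x ` {..<n})"
    by blast
  obtain c where c: "\<And>j. j < n \<Longrightarrow> inner (z - (\<Sum>i<n. c i *\<^sub>R x i)) (x j) = 0"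
    using orthogonal_projection_onto_finite_span[of n z x] by blast
  define v where "v = z - (\<Sum>i<n. c i *\<^sub>R x i)"
  have "(\<Sum>i<n. c i *\<^sub>R x i) \<in> span (x ` {..<n})"
    by (intro span_sum span_scale span_base) auto
  with z have "v \<noteq> 0"
    by (auto simp: v_def)
  with c show ?thesis
    by (intro exI[of _ "v /\<^sub>R norm v"]) (auto simp: v_def)
qed

lemma orthonormal_sequence_exists:
  assumes "infinite_dimensional TYPE('h::real_inner)"
  obtains e :: "nat \<Rightarrow> 'h::real_inner" where "\<And>i j. inner (e i) (e j) = (if i = j then 1 else 0)"
proof -
  have "\<exists>e :: nat \<Rightarrow> 'h. \<forall>n. norm (e n) = 1 \<and> (\<forall>j<n. inner (e n) (e j) = 0)"
  proof (rule dependent_wf_choice[where R = less_than])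
    show "\<exists>r. norm r = 1 \<and> (\<forall>j<n. inner r (x j) = 0)" for n and x :: "nat \<Rightarrow> 'h"
      using unit_vector_orthogonal_to_finitely_many[OF assms] by blast
  qed (auto simp: less_than_iff)
  then obtain e :: "nat \<Rightarrow> 'h"
    where norm: "\<And>n. norm (e n) = 1" and lower: "\<And>n j. j < n \<Longrightarrow> inner (e n) (e j) = 0"
    by blast
  have "inner (e i) (e j) = (if i = j then 1 else 0)" for i j
    using norm[of i] lower[of i j] lower[of j i]
    by (cases i j rule: linorder_cases) (auto simp: inner_commute dot_square_norm)
  then show thesis
    by (rule that)
qed

text \<open>The Cholesky decomposition of a Gram matrix. The new vector \<open>x n\<close> splits into a combination \<open>p\<close> of
  the previous vectors and an orthogonal part \<open>q\<close>; copy the combination to the vectors already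
  realized and use the fresh direction \<open>e n\<close> for the orthogonal part.\<close>

lemma triangular_realization:
  fixes x :: "nat \<Rightarrow> 'g::real_inner" and e :: "nat \<Rightarrow> 'h::real_inner"
  assumes e: "\<And>i j. inner (e i) (e j) = (if i = j then 1 else 0)"
  shows "\<exists>c. \<forall>i<n. \<forall>j<n.
    inner (\<Sum>k\<le>i. c i k *\<^sub>R e k) (\<Sum>k\<le>j. c j k *\<^sub>R e k) = inner (x i) (x j)"
proof (induction n)
  case 0
  show ?case by simp
next
  case (Suc n)
  then obtain c where c: "\<And>i j. i < n \<Longrightarrow> j < n \<Longrightarrow>
      inner (\<Sum>k\<le>i. c i k *\<^sub>R e k) (\<Sum>k\<le>j. c j k *\<^sub>R e k) = inner (x i) (x j)"
    by blast
  define y where "y i = (\<Sum>k\<le>i. c i k *\<^sub>R e k)" for i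
  obtain a where a: "\<And>j. j < n \<Longrightarrow> inner (x n - (\<Sum>i<n. a i *\<^sub>R x i)) (x j) = 0"
    using orthogonal_projection_onto_finite_span[of n "x n" x] by blast
  define p q where "p = (\<Sum>i<n. a i *\<^sub>R x i)" and "q = x n - p"
  define p' where "p' = (\<Sum>i<n. a i *\<^sub>R y i)"
  define cn where "cn k = (if k = n then norm q else \<Sum>i\<in>{k..<n}. a i * c i k)" for k
  have p'_alt: "p' = (\<Sum>k<n. cn k *\<^sub>R e k)"
  proof -
    have "p' = (\<Sum>i<n. \<Sum>k\<le>i. (a i * c i k) *\<^sub>R e k)"
      by (simp add: p'_def y_def scaleR_sum_right)
    also have "\<dots> = (\<Sum>k<n. \<Sum>i\<in>{k..<n}. (a i * c i k) *\<^sub>R e k)"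
      unfolding sum.Sigma[OF finite_lessThan ballI[OF finite_atMost]]
        sum.Sigma[OF finite_lessThan ballI[OF finite_atLeastLessThan]]
      by (rule sum.reindex_bij_witness[of _ "\<lambda>(k, i). (i, k)" "\<lambda>(i, k). (k, i)"]) auto
    also have "\<dots> = (\<Sum>k<n. cn k *\<^sub>R e k)"
      by (simp add: cn_def scaleR_sum_left)
    finally show ?thesis .
  qed
  have yn: "(\<Sum>k\<le>n. cn k *\<^sub>R e k) = p' + norm q *\<^sub>R e n"
    by (simp add: p'_alt cn_def flip: lessThan_Suc_atMost)
  have e_y: "inner (e n) (y i) = 0" if "i < n" for i
    using that by (simp add: y_def inner_sum_right e)
  then have e_p': "inner (e n) p' = 0"
    by (simp add: p'_def inner_sum_right)
  have q_p: "inner q p = 0"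
    using a by (simp add: p_def q_def inner_sum_right)
  have yy: "inner (y i) (y j) = inner (x i) (x j)" if "i < n" "j < n" for i j
    using c[OF that] by (simp add: y_def)
  have p'_y: "inner p' (y j) = inner p (x j)" if "j < n" for j
    using that by (simp add: p_def p'_def inner_sum_left yy)
  have p'_p': "inner p' p' = inner p p"
  proof -
    have "inner p' p' = (\<Sum>j<n. a j * inner p' (y j))"
      by (simp add: p'_def inner_sum_right)
    also have "\<dots> = (\<Sum>j<n. a j * inner p (x j))"
      by (simp add: p'_y)
    also have "\<dots> = inner p p"
      by (simp add: p_def inner_sum_right)
    finally show ?thesis .
  qed
  have new_old: "inner (p' + norm q *\<^sub>R e n) (y j) = inner (x n) (x j)" if "j < n" for j
    using a[OF that] that
    by (simp add: inner_add_left e_y p'_y flip: p_def) (simp add: inner_diff_left)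
  then have old_new: "inner (y j) (p' + norm q *\<^sub>R e n) = inner (x j) (x n)" if "j < n" for j
    using that by (metis inner_commute)
  have new_new: "inner (p' + norm q *\<^sub>R e n) (p' + norm q *\<^sub>R e n) = inner (x n) (x n)"
  proof -
    have "inner (p' + norm q *\<^sub>R e n) (p' + norm q *\<^sub>R e n)
        = inner p' p' + norm q * norm q * inner (e n) (e n)"
      by (simp add: inner_add_left inner_add_right inner_commute[of p' "e n"] e_p'
          del: dot_square_norm)
    also have "\<dots> = inner p p + inner q q"
      by (simp only: p'_p' e) (simp add: dot_square_norm power2_eq_square)
    also have "\<dots> = inner (p + q) (p + q)"
      using q_p by (simp add: inner_add_left inner_add_right inner_commute)
    finally show ?thesis
      by (simp add: q_def)
  qed
  show ?case
  proof (intro exI[of _ "c(n := cn)"] allI impI)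
    fix i j
    assume "i < Suc n" "j < Suc n"
    then consider "i < n" "j < n" | "i = n" "j < n" | "i < n" "j = n" | "i = n" "j = n"
      by linarith
    then show "inner (\<Sum>k\<le>i. (c(n := cn)) i k *\<^sub>R e k) (\<Sum>k\<le>j. (c(n := cn)) j k *\<^sub>R e k)
        = inner (x i) (x j)"
      by cases (simp_all add: yn yy new_old old_new new_new del: dot_square_norm flip: y_def)
  qed
qed

text \<open>Realize the first \<open>n\<close> points of the \<open>n\<close>-th array by triangular coordinates with respect to one
  orthonormal sequence \<open>e\<close>. The coordinates of the \<open>i\<close>-th point are bounded by its norm, so all
  coordinates together lie in a product of compact intervals, and a convergent subsequence of
  coordinates yields convergent points, each being a combination of a fixed finite number of
  vectors of \<open>e\<close>.\<close>

lemma bounded_arrays_subconverge: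
  fixes x :: "nat \<Rightarrow> nat \<Rightarrow> 'g::real_inner"
  assumes "infinite_dimensional TYPE('h::real_inner)"
    and bound: "\<And>n i. norm (x n i) \<le> R i"
  obtains r :: "nat \<Rightarrow> nat" and y :: "nat \<Rightarrow> 'h::real_inner" where "strict_mono r"
    and "\<And>i j. (\<lambda>n. dist (x (r n) i) (x (r n) j)) \<longlonglongrightarrow> dist (y i) (y j)"
proof -
  obtain e :: "nat \<Rightarrow> 'h" where e: "\<And>i j. inner (e i) (e j) = (if i = j then 1 else 0)"
    using orthonormal_sequence_exists[OF assms(1)] by blast
  have "\<exists>c. \<forall>i<n. \<forall>j<n. inner (\<Sum>k\<le>i. c i k *\<^sub>R e k) (\<Sum>k\<le>j. c j k *\<^sub>R e k)
          = inner (x n i) (x n j)" for n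
    by (rule triangular_realization[OF e])
  then obtain c where c: "\<And>n i j. i < n \<Longrightarrow> j < n \<Longrightarrow>
      inner (\<Sum>k\<le>i. c n i k *\<^sub>R e k) (\<Sum>k\<le>j. c n j k *\<^sub>R e k) = inner (x n i) (x n j)"
    by metis
  define z where "z n i = (\<Sum>k\<le>i. c n i k *\<^sub>R e k)" for n i
  have z_dist: "dist (z n i) (z n j) = dist (x n i) (x n j)" if "i < n" "j < n" for n i j
    unfolding dist_norm norm_eq_sqrt_inner z_def
    using that by (simp add: inner_diff_left inner_diff_right c)
  have c_bound: "\<bar>c n i k\<bar> \<le> R i" if "i < n" "k \<le> i" for n i k
  proof -
    have "inner (z n i) (e k) = c n i k"
      using that by (simp add: z_def inner_sum_left e if_distrib[of "\<lambda>t. _ * t"] cong: if_cong)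
    moreover have "\<bar>inner (z n i) (e k)\<bar> \<le> norm (z n i) * norm (e k)"
      by (rule Cauchy_Schwarz_ineq2)
    moreover have "norm (e k) = 1"
      by (simp add: norm_eq_sqrt_inner e)
    moreover have "norm (z n i) = norm (x n i)"
      using that by (simp add: norm_eq_sqrt_inner z_def c)
    ultimately show ?thesis
      using bound[of n i] by simp
  qed
  have R: "0 \<le> R i" for i
    using order_trans[OF norm_ge_zero bound] .
  define K where "K = (PiE UNIV (\<lambda>(i, k). {- R i..R i}) :: (nat \<times> nat \<Rightarrow> real) set)"
  \<comment> \<open>Outside the realized range the coefficients are arbitrary; zero keeps them in \<open>K\<close>.\<close>
  define C where "C n = (\<lambda>(i, k). if i < n \<and> k \<le> i then c n i k else 0)" for n
  have "compactin euclidean K"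
    unfolding K_def by (subst euclidean_product_topology[symmetric]) (auto simp: compactin_PiE)
  then have "seq_compact K"
    by (auto intro: compact_imp_seq_compact)
  moreover have "C n \<in> K" for n
    using c_bound R by (fastforce simp: K_def C_def abs_le_iff minus_le_iff)
  ultimately obtain l r where r: "strict_mono r" and lim: "(C \<circ> r) \<longlonglongrightarrow> l"
    using seq_compactE by metis
  have lim_c: "(\<lambda>n. C (r n) p) \<longlonglongrightarrow> l p" for p
  proof -
    have "continuous_on UNIV (\<lambda>f :: nat \<times> nat \<Rightarrow> real. f p)"
      by (rule continuous_on_product_coordinates)
    then have "isCont (\<lambda>f :: nat \<times> nat \<Rightarrow> real. f p) l"
      by (rule continuous_on_interior) simp
    from isCont_tendsto_compose[OF this lim] show ?thesis
      by (simp add: o_def)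
  qed
  define y where "y i = (\<Sum>k\<le>i. l (i, k) *\<^sub>R e k)" for i
  have large: "\<forall>\<^sub>F n in sequentially. i < r n" for i
    by (rule eventually_sequentiallyI[of "Suc i"]) (use seq_suble[OF r] in \<open>auto simp: Suc_le_eq intro: less_le_trans\<close>)
  have z_lim: "(\<lambda>n. z (r n) i) \<longlonglongrightarrow> y i" for i
  proof (rule Lim_transform_eventually)
    show "(\<lambda>n. \<Sum>k\<le>i. C (r n) (i, k) *\<^sub>R e k) \<longlonglongrightarrow> y i"
      unfolding y_def by (intro tendsto_intros lim_c)
    show "\<forall>\<^sub>F n in sequentially. (\<Sum>k\<le>i. C (r n) (i, k) *\<^sub>R e k) = z (r n) i"
      using large[of i] by eventually_elim (simp add: C_def z_def)
  qed
  have "(\<lambda>n. dist (x (r n) i) (x (r n) j)) \<longlonglongrightarrow> dist (y i) (y j)" for i j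
  proof (rule Lim_transform_eventually)
    show "(\<lambda>n. dist (z (r n) i) (z (r n) j)) \<longlonglongrightarrow> dist (y i) (y j)"
      by (intro tendsto_intros z_lim)
    show "\<forall>\<^sub>F n in sequentially.
        dist (z (r n) i) (z (r n) j) = dist (x (r n) i) (x (r n) j)"
      using large[of i] large[of j] by eventually_elim (simp add: z_dist)
  qed
  with r show thesis
    by (rule that)
qed

section \<open>Finite trees\<close>

text \<open>Every finite tree grows from any of its vertices by successively adding leaves. The proof keeps the
  invariant that any two vertices of the part \<open>U\<close> built so far are joined by a simple path inside \<open>U\<close>.
  A new vertex with two neighbors in \<open>U\<close> would close the path between them to a cycle.\<close>

lemma finite_tree_leaf_induct [consumes 2, case_names root leaf]:
  assumes tree: "finite_tree V E" and "r \<in> V"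
    and root: "P {r}"
    and leaf: "\<And>U u v. P U \<Longrightarrow> finite U \<Longrightarrow> U \<subseteq> V \<Longrightarrow> u \<in> U \<Longrightarrow> v \<in> V - U \<Longrightarrow> (u, v) \<in> E
        \<Longrightarrow> (\<And>u'. u' \<in> U \<Longrightarrow> (u', v) \<in> E \<Longrightarrow> u' = u) \<Longrightarrow> P (insert v U)"
  shows "P V"
proof -
  have "finite V" and sym: "sym E" and reach: "\<And>u v. u \<in> V \<Longrightarrow> v \<in> V \<Longrightarrow> (u, v) \<in> E\<^sup>*"
    and EV: "E \<subseteq> V \<times> V"
    and acyclic: "\<And>c. length c \<ge> 3 \<Longrightarrow> distinct c \<Longrightarrow> successively (\<lambda>u v. (u, v) \<in> E) c
        \<Longrightarrow> (last c, hd c) \<notin> E"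
    using tree unfolding finite_tree_def by blast+
  define path where "path U u v c \<longleftrightarrow> c \<noteq> [] \<and> hd c = u \<and> last c = v \<and> set c \<subseteq> U \<and> distinct c
      \<and> successively (\<lambda>u v. (u, v) \<in> E) c" for U u v c
  define conn where "conn U \<longleftrightarrow> (\<forall>u\<in>U. \<forall>v\<in>U. \<exists>c. path U u v c)" for U
  have connD: "\<exists>c. path U u v c" if "conn U" "u \<in> U" "v \<in> U" for U u v
    using that by (simp add: conn_def)
  have "\<exists>U. r \<in> U \<and> U \<subseteq> V \<and> card U = Suc n \<and> conn U \<and> P U" if "n < card V" for n
    using that
  proof (induction n)
    case 0
    have "path {r} r r [r]"
      by (simp add: path_def)
    then show ?case
      using \<open>r \<in> V\<close> root by (intro exI[of _ "{r}"]) (auto simp: conn_def)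
  next
    case (Suc n)
    then obtain U where U: "r \<in> U" "U \<subseteq> V" "card U = Suc n" "conn U" "P U"
      by auto
    have "finite U"
      using U(2) \<open>finite V\<close> by (rule finite_subset)
    have "U \<noteq> V"
      using U(3) Suc.prems by auto
    then obtain v0 where v0: "v0 \<in> V" "v0 \<notin> U"
      using U(2) by blast
    have "\<exists>u\<in>U. \<exists>v. v \<notin> U \<and> (u, v) \<in> E"
    proof (rule ccontr)
      assume "\<not> ?thesis"
      then have closed: "\<And>u v. u \<in> U \<Longrightarrow> (u, v) \<in> E \<Longrightarrow> v \<in> U"
        by blast
      have "v \<in> U" if "(r, v) \<in> E\<^sup>*" for v
        using that by (induction rule: rtrancl_induct) (use U(1) closed in auto)
      with assms(2) reach v0 show False by blast
    qed
    then obtain u v where uv: "u \<in> U" "v \<notin> U" "(u, v) \<in> E" by blast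
    have vu: "(v, u) \<in> E"
      using sym uv(3) by (rule symD)
    have v: "v \<in> V"
      using uv(3) EV by blast
    have unique: "u' = u" if u': "u' \<in> U" "(u', v) \<in> E" for u'
    proof (rule ccontr)
      assume "u' \<noteq> u"
      obtain c where c: "path U u u' c"
        using connD[OF U(4) uv(1) u'(1)] by blast
      then have "c \<noteq> []" "hd c \<noteq> last c"
        using \<open>u' \<noteq> u\<close> by (auto simp: path_def)
      then have "length c \<ge> 2"
        by (cases c rule: remdups_adj.cases) auto
      have "(last (v # c), hd (v # c)) \<notin> E"
      proof (rule acyclic)
        show "3 \<le> length (v # c)"
          using \<open>length c \<ge> 2\<close> by simp
        show "distinct (v # c)"
          using c uv(2) unfolding path_def by auto
        show "successively (\<lambda>u v. (u, v) \<in> E) (v # c)"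
          using c vu unfolding path_def successively_Cons by simp
      qed
      moreover have "last (v # c) = u'"
        using c unfolding path_def by simp
      ultimately show False
        using u'(2) by simp
    qed
    have "\<exists>c. path (insert v U) x y c" if "x \<in> insert v U" "y \<in> insert v U" for x y
    proof (cases "x = v")
      case True
      show ?thesis
      proof (cases "y = v")
        case True
        with \<open>x = v\<close> have "path (insert v U) x y [v]"
          by (simp add: path_def)
        then show ?thesis ..
      next
        case False
        then have "y \<in> U" using that by simp
        then obtain c where "path U u y c"
          using connD[OF U(4) uv(1)] by blast
        then have "path (insert v U) x y (v # c)"
          using \<open>x = v\<close> uv(2) vu unfolding path_def successively_Cons by auto
        then show ?thesis ..
      qed
    next
      case False
      then have "x \<in> U" using that by simp
      show ?thesis
      proof (cases "y = v")
        case True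
        obtain c where "path U x u c"
          using connD[OF U(4) \<open>x \<in> U\<close> uv(1)] by blast
        then have "path (insert v U) x y (c @ [v])"
          using True uv(2,3) unfolding path_def successively_append_iff by auto
        then show ?thesis ..
      next
        case False
        then have "y \<in> U" using that by simp
        then obtain c where "path U x y c"
          using connD[OF U(4) \<open>x \<in> U\<close>] by blast
        then have "path (insert v U) x y c"
          unfolding path_def by auto
        then show ?thesis ..
      qed
    qed
    then have "conn (insert v U)"
      unfolding conn_def by blast
    moreover have "P (insert v U)"
      using leaf[OF U(5) \<open>finite U\<close> U(2) uv(1) _ uv(3) unique] v uv(2) by blast
    ultimately show ?case
      using U(1-3) v uv(2) \<open>finite U\<close> by (intro exI[of _ "insert v U"]) auto
  qed
  moreover have "card V - 1 < card V"
    using \<open>finite V\<close> \<open>r \<in> V\<close> by (auto simp: card_gt_0_iff intro!: diff_less)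
  ultimately obtain U where "U \<subseteq> V" "card U = Suc (card V - 1)" "P U"
    by blast
  moreover from this have "card U = card V"
    using \<open>card V - 1 < card V\<close> by simp
  ultimately show "P V"
    using \<open>finite V\<close> by (metis card_subset_eq)
qed

definition parent_edges :: "(nat \<Rightarrow> nat) \<Rightarrow> nat \<Rightarrow> nat rel" where
  "parent_edges par n = {(i, j). i \<le> n \<and> j \<le> n \<and> (i < j \<and> i = par j \<or> j < i \<and> j = par i)}"

text \<open>In a cycle, both neighbors of the largest vertex are smaller than it, so both are its parent;
  but they are distinct.\<close>

lemma finite_tree_parent_edges:
  assumes par: "\<And>j. j > 0 \<Longrightarrow> par j < j"
  shows "finite_tree {..n} (parent_edges par n)"
  unfolding finite_tree_def
proof (intro conjI ballI notI)
  let ?E = "parent_edges par n"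
  show sym: "sym ?E" and "irrefl ?E" and "?E \<subseteq> {..n} \<times> {..n}"
    by (auto simp: parent_edges_def sym_def irrefl_def)
  have to_root: "(j, 0) \<in> ?E\<^sup>*" if "j \<le> n" for j
    using that
  proof (induction j rule: less_induct)
    case (less j)
    show ?case
    proof (cases "j = 0")
      case False
      then have "(j, par j) \<in> ?E" "par j < j"
        using par[of j] less.prems by (auto simp: parent_edges_def)
      then show ?thesis
        using less by (meson converse_rtrancl_into_rtrancl less_imp_le order_trans)
    qed simp
  qed
  show "(u, v) \<in> ?E\<^sup>*" if "u \<in> {..n}" "v \<in> {..n}" for u v
    using to_root[of u] to_root[of v] that sym_rtrancl[OF sym]
    by (meson atMost_iff rtrancl_trans symD)
  assume "\<exists>c. length c \<ge> 3 \<and> distinct c \<and> successively (\<lambda>u v. (u, v) \<in> ?E) c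
      \<and> (last c, hd c) \<in> ?E"
  then obtain c where len: "length c \<ge> 3" and "distinct c"
    and succ: "successively (\<lambda>u v. (u, v) \<in> ?E) c" and close: "(last c, hd c) \<in> ?E"
    by blast
  have "c \<noteq> []" using len by auto
  define m where "m = Max (set c)"
  have "m \<in> set c" and max: "\<And>u. u \<in> set c \<Longrightarrow> u \<le> m"
    using \<open>c \<noteq> []\<close> by (auto simp: m_def)
  then obtain k where k: "k < length c" "c ! k = m"
    by (auto simp: in_set_conv_nth)
  define prv nxt where "prv = (if k = 0 then length c - 1 else k - 1)"
    and "nxt = (if Suc k = length c then 0 else Suc k)"
  have bounds: "prv < length c" "nxt < length c" and "prv \<noteq> nxt"
    using k len by (auto simp: prv_def nxt_def)
  have "(c ! prv, m) \<in> ?E"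
    using succ close k \<open>c \<noteq> []\<close>
    by (cases k) (auto simp: prv_def successively_conv_nth last_conv_nth hd_conv_nth)
  moreover have "(m, c ! nxt) \<in> ?E"
  proof (cases "Suc k = length c")
    case True
    then have "length c - 1 = k" by simp
    with True close k \<open>c \<noteq> []\<close> show ?thesis
      by (simp add: nxt_def last_conv_nth hd_conv_nth)
  next
    case False
    with succ k show ?thesis
      by (auto simp: nxt_def successively_conv_nth)
  qed
  ultimately have "c ! prv = par m" "c ! nxt = par m"
    using max[OF nth_mem[OF bounds(1)]] max[OF nth_mem[OF bounds(2)]]
    by (auto simp: parent_edges_def)
  then show False
    using nth_eq_iff_index_eq[OF \<open>distinct c\<close> bounds] \<open>prv \<noteq> nxt\<close> by simp
qed auto

section \<open>Submetries from subsets of Hilbert spaces satisfy tree comparison\<close>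

text \<open>Distances between the lifts of vertices that are not adjacent also need a bound \<open>B\<close> which is the
  same for all \<open>\<epsilon>\<close>, since the lifts are subjected to a compactness argument as \<open>\<epsilon>\<close> tends to \<open>0\<close>.\<close>

lemma approximate_tree_lifts:
  fixes E :: "'v rel"
  assumes tree: "finite_tree V E"
    and maps: "\<And>w. w \<in> S \<Longrightarrow> f w \<in> mspace Y" and onto: "f ` S = mspace Y"
    and lift: "\<And>w y r. w \<in> S \<Longrightarrow> y \<in> mspace Y \<Longrightarrow> mdist Y (f w) y < r
        \<Longrightarrow> \<exists>w'\<in>S. f w' = y \<and> dist w w' < r"
    and a: "a \<in> V \<rightarrow> mspace Y"
  obtains B where "\<And>\<epsilon>. 0 < \<epsilon> \<Longrightarrow> \<epsilon> \<le> 1 \<Longrightarrow> \<exists>w. (\<forall>i\<in>V. w i \<in> S \<and> f (w i) = a i)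
      \<and> (\<forall>(i, j)\<in>E. dist (w i) (w j) \<le> mdist Y (a i) (a j) + \<epsilon>)
      \<and> (\<forall>i\<in>V. \<forall>j\<in>V. dist (w i) (w j) \<le> B)"
proof -
  define Q where "Q U w \<epsilon> B \<longleftrightarrow> (\<forall>i\<in>U. w i \<in> S \<and> f (w i) = a i)
      \<and> (\<forall>i\<in>U. \<forall>j\<in>U. (i, j) \<in> E \<longrightarrow> dist (w i) (w j) \<le> mdist Y (a i) (a j) + \<epsilon>)
      \<and> (\<forall>i\<in>U. \<forall>j\<in>U. dist (w i) (w j) \<le> B)" for U w \<epsilon> and B :: real
  have "V \<noteq> {}" "sym E" "irrefl E" "E \<subseteq> V \<times> V"
    using tree by (auto simp: finite_tree_def)
  then obtain r where "r \<in> V" by blast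
  from tree this have "\<exists>B. \<forall>\<epsilon>. 0 < \<epsilon> \<longrightarrow> \<epsilon> \<le> 1 \<longrightarrow> (\<exists>w. Q V w \<epsilon> B)"
  proof (induction rule: finite_tree_leaf_induct)
    case root
    have "a r \<in> f ` S"
      using a \<open>r \<in> V\<close> onto by blast
    then obtain w0 where "w0 \<in> S" "f w0 = a r"
      by auto
    then have "Q {r} (\<lambda>_. w0) \<epsilon> 0" if "0 < \<epsilon>" for \<epsilon>
      using that by (auto simp: Q_def add_nonneg_nonneg)
    then show ?case by blast
  next
    case (leaf U u v)
    then obtain B where B: "\<And>\<epsilon>. 0 < \<epsilon> \<Longrightarrow> \<epsilon> \<le> 1 \<Longrightarrow> \<exists>w. Q U w \<epsilon> B"
      by blast
    have "u \<in> U" "v \<notin> U" "v \<in> V"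
      using leaf.hyps by blast+
    then have v: "a v \<in> mspace Y"
      using a by blast
    \<comment> \<open>The new edge has length at most \<open>mdist Y (a u) (a v) + 1\<close>, because \<open>\<epsilon> \<le> 1\<close>.\<close>
    define B' where "B' = B + (mdist Y (a u) (a v) + 1)"
    have "\<exists>w'. Q (insert v U) w' \<epsilon> B'" if \<epsilon>: "0 < \<epsilon>" "\<epsilon> \<le> 1" for \<epsilon>
    proof -
      obtain w where w: "Q U w \<epsilon> B"
        using B \<epsilon> by blast
      then have wu: "w u \<in> S" "f (w u) = a u"
        using \<open>u \<in> U\<close> unfolding Q_def by blast+
      have "0 \<le> B"
        using w \<open>u \<in> U\<close> order_trans[OF zero_le_dist] unfolding Q_def by blast
      have "mdist Y (f (w u)) (a v) < mdist Y (a u) (a v) + \<epsilon>"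
        using \<epsilon> wu by simp
      then obtain w' where w': "w' \<in> S" "f w' = a v" "dist (w u) w' < mdist Y (a u) (a v) + \<epsilon>"
        using lift[OF wu(1) v] by blast
      have far: "dist (w i) w' \<le> B'" if "i \<in> U" for i
      proof -
        have "dist (w i) w' \<le> dist (w i) (w u) + dist (w u) w'"
          by (rule dist_triangle)
        moreover have "dist (w i) (w u) \<le> B"
          using w that \<open>u \<in> U\<close> by (auto simp: Q_def)
        ultimately show ?thesis
          using w'(3) \<epsilon> by (simp add: B'_def)
      qed
      have "B \<le> B'" "0 \<le> B'"
        using \<open>0 \<le> B\<close> by (auto simp: B'_def add_nonneg_nonneg)
      have new: "dist (w i) w' \<le> mdist Y (a i) (a v) + \<epsilon>" if "i \<in> U" "(i, v) \<in> E" for i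
        using leaf.hyps(6)[OF that] w'(3) by simp
      have new': "dist w' (w i) \<le> mdist Y (a v) (a i) + \<epsilon>" if "i \<in> U" "(v, i) \<in> E" for i
        using new[OF that(1) symD[OF \<open>sym E\<close> that(2)]] by (simp add: dist_commute mdist_commute)
      have "(v, v) \<notin> E"
        using \<open>irrefl E\<close> by (auto simp: irrefl_def)
      have "Q (insert v U) (w(v := w')) \<epsilon> B'"
        unfolding Q_def
      proof (intro conjI ballI impI)
        fix i assume i: "i \<in> insert v U"
        show "(w(v := w')) i \<in> S" "f ((w(v := w')) i) = a i"
          using i w w' by (auto simp: Q_def)
        fix j assume j: "j \<in> insert v U"
        show "dist ((w(v := w')) i) ((w(v := w')) j) \<le> B'"
          using i j w far \<open>B \<le> B'\<close> \<open>0 \<le> B'\<close> \<open>v \<notin> U\<close>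
          by (fastforce simp: Q_def dist_commute intro: order_trans[of _ B B'])
        assume "(i, j) \<in> E"
        with i j w new new' \<open>v \<notin> U\<close> \<open>(v, v) \<notin> E\<close>
        show "dist ((w(v := w')) i) ((w(v := w')) j) \<le> mdist Y (a i) (a j) + \<epsilon>"
          by (auto simp: Q_def)
      qed
      then show ?thesis by blast
    qed
    then show ?case by blast
  qed
  then obtain B where "\<And>\<epsilon>. 0 < \<epsilon> \<Longrightarrow> \<epsilon> \<le> 1 \<Longrightarrow> \<exists>w. Q V w \<epsilon> B"
    by blast
  then show thesis
    using \<open>E \<subseteq> V \<times> V\<close> by (intro that[of B]) (fastforce simp: Q_def)
qed

lemma submetry_short:
  assumes "submetry (submetric euclidean_metric S) Y f" "w \<in> S" "w' \<in> S"
  shows "mdist Y (f w) (f w') \<le> dist w w'"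
proof (rule field_le_epsilon)
  fix \<epsilon> :: real assume "\<epsilon> > 0"
  then have "w' \<in> mball_of (submetric euclidean_metric S) w (dist w w' + \<epsilon>)"
    using assms by simp
  moreover have "0 \<le> dist w w' + \<epsilon>"
    using \<open>\<epsilon> > 0\<close> by (simp add: add_nonneg_nonneg)
  ultimately have "f w' \<in> mball_of Y (f w) (dist w w' + \<epsilon>)"
    using assms unfolding submetry_def by (metis IntI UNIV_I imageI mspace_euclidean_metric mspace_submetric)
  then show "mdist Y (f w) (f w') \<le> dist w w' + \<epsilon>"
    by simp
qed

lemma submetry_lift:
  assumes "submetry (submetric euclidean_metric S) Y f" "w \<in> S" "y \<in> mspace Y"
    and "mdist Y (f w) y < r"
  shows "\<exists>w'\<in>S. f w' = y \<and> dist w w' < r"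
proof -
  have r: "0 \<le> r"
    using assms(4) mdist_nonneg[of Y "f w" y] by linarith
  have "f w \<in> mspace Y"
    using assms(1,2) by (auto simp: submetry_def)
  then have "y \<in> mball_of Y (f w) r"
    using assms by simp
  also have "mball_of Y (f w) r = f ` mball_of (submetric euclidean_metric S) w r"
    using assms(1,2) r by (simp add: submetry_def)
  finally show ?thesis
    by auto
qed

text \<open>The comparison array is a limit of \<open>1/(n+1)\<close>-approximate lifts. Each lift is translated so
  that a fixed vertex \<open>v0\<close> goes to the origin, which makes the lifts uniformly bounded.\<close>

lemma submetry_imp_array_tree_comparison:
  fixes S :: "'s::real_inner set" and V :: "nat set"
  assumes inf: "infinite_dimensional TYPE('h::real_inner)"
    and f: "submetry (submetric euclidean_metric S) Y f"
    and tree: "finite_tree V E" and a: "a \<in> V \<rightarrow> mspace Y"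
  shows "array_tree_comparison TYPE('h) V E Y a"
proof -
  have onto: "f ` S = mspace Y"
    using f by (simp add: submetry_def)
  obtain B where B: "\<And>\<epsilon>. 0 < \<epsilon> \<Longrightarrow> \<epsilon> \<le> 1 \<Longrightarrow> \<exists>w. (\<forall>i\<in>V. w i \<in> S \<and> f (w i) = a i)
      \<and> (\<forall>(i, j)\<in>E. dist (w i) (w j) \<le> mdist Y (a i) (a j) + \<epsilon>)
      \<and> (\<forall>i\<in>V. \<forall>j\<in>V. dist (w i) (w j) \<le> B)"
    by (rule approximate_tree_lifts[OF tree _ onto submetry_lift[OF f] a]) (use onto in blast)+
  define good where "good n w \<longleftrightarrow> (\<forall>i\<in>V. w i \<in> S \<and> f (w i) = a i)
      \<and> (\<forall>(i, j)\<in>E. dist (w i) (w j) \<le> mdist Y (a i) (a j) + inverse (real (Suc n)))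
      \<and> (\<forall>i\<in>V. \<forall>j\<in>V. dist (w i) (w j) \<le> B)" for n w
  have "\<exists>w. good n w" for n
    unfolding good_def by (rule B) (auto simp: field_simps)
  then obtain w where good: "\<And>n. good n (w n)"
    by metis
  have w: "w n i \<in> S \<and> f (w n i) = a i" if "i \<in> V" for n i
    using good[of n] that by (simp add: good_def)
  have w_edge: "dist (w n i) (w n j) \<le> mdist Y (a i) (a j) + inverse (real (Suc n))"
    if "(i, j) \<in> E" for n i j
    using good[of n] that unfolding good_def by fast
  have w_bound: "dist (w n i) (w n j) \<le> B" if "i \<in> V" "j \<in> V" for n i j
    using good[of n] that by (simp add: good_def)
  obtain v0 where "v0 \<in> V" and EV: "E \<subseteq> V \<times> V"
    using tree by (auto simp: finite_tree_def)
  define x where "x n i = (if i \<in> V then w n i - w n v0 else 0)" for n i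
  have x_dist: "dist (x n i) (x n j) = dist (w n i) (w n j)" if "i \<in> V" "j \<in> V" for n i j
    using that by (simp add: x_def dist_norm)
  have "0 \<le> B"
    using w_bound[OF \<open>v0 \<in> V\<close> \<open>v0 \<in> V\<close>] by simp
  then have "norm (x n i) \<le> B" for n i
    using w_bound[of i v0 n] \<open>v0 \<in> V\<close> by (simp add: x_def dist_norm)
  then obtain r and b :: "nat \<Rightarrow> 'h" where r: "strict_mono r"
    and lim: "\<And>i j. (\<lambda>n. dist (x (r n) i) (x (r n) j)) \<longlonglongrightarrow> dist (b i) (b j)"
    using bounded_arrays_subconverge[OF inf, of x "\<lambda>_. B"] by blast
  have lower: "mdist Y (a i) (a j) \<le> dist (b i) (b j)" if "i \<in> V" "j \<in> V" for i j
  proof (rule LIMSEQ_le_const[OF lim])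
    have "mdist Y (a i) (a j) \<le> dist (x (r n) i) (x (r n) j)" for n
      using submetry_short[OF f, of "w (r n) i" "w (r n) j"] w that by (simp add: x_dist)
    then show "\<exists>N. \<forall>n\<ge>N. mdist Y (a i) (a j) \<le> dist (x (r n) i) (x (r n) j)"
      by blast
  qed
  have upper: "dist (b i) (b j) \<le> mdist Y (a i) (a j)" if "(i, j) \<in> E" for i j
  proof (rule LIMSEQ_le[OF lim])
    have "(\<lambda>n. mdist Y (a i) (a j) + inverse (real (Suc n))) \<longlonglongrightarrow> mdist Y (a i) (a j) + 0"
      by (intro tendsto_intros LIMSEQ_inverse_real_of_nat)
    from LIMSEQ_subseq_LIMSEQ[OF this r]
    show "(\<lambda>n. mdist Y (a i) (a j) + inverse (real (Suc (r n)))) \<longlonglongrightarrow> mdist Y (a i) (a j)"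
      by (simp add: o_def)
    show "\<exists>N. \<forall>n\<ge>N. dist (x (r n) i) (x (r n) j)
        \<le> mdist Y (a i) (a j) + inverse (real (Suc (r n)))"
      using w_edge[OF that] that EV by (auto simp: x_dist)
  qed
  have "dist (b i) (b j) = mdist Y (a i) (a j)" if "(i, j) \<in> E" for i j
  proof (rule antisym[OF upper[OF that]])
    show "mdist Y (a i) (a j) \<le> dist (b i) (b j)"
      using that EV by (intro lower) auto
  qed
  with lower show ?thesis
    unfolding array_tree_comparison_def by (intro exI[of _ b]) auto
qed

lemma submetry_target_imp_all_tree_comparisons:
  fixes X :: "'a metric"
  assumes "infinite_dimensional TYPE('h::real_inner)"
    and "isometric_to_submetry_target TYPE('s::{real_inner, complete_space}) X"
  shows "all_tree_comparisons TYPE('h) X"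
  unfolding all_tree_comparisons_def tree_comparison_def
proof (intro allI impI ballI)
  fix V :: "nat set" and E a
  assume tree: "finite_tree V E" and a: "a \<in> V \<rightarrow> mspace X"
  obtain S :: "'s set" and Y :: "'a metric" and f where f: "submetry (submetric euclidean_metric S) Y f"
    and iso: "isometric_spaces X Y"
    using assms(2) unfolding isometric_to_submetry_target_def by blast
  obtain g where g: "bij_betw g (mspace X) (mspace Y)"
      "\<And>x x'. x \<in> mspace X \<Longrightarrow> x' \<in> mspace X \<Longrightarrow> mdist Y (g x) (g x') = mdist X x x'"
    using iso unfolding isometric_spaces_def by blast
  have "g \<circ> a \<in> V \<rightarrow> mspace Y"
    using bij_betwE[OF g(1)] Pi_mem[OF a] by auto
  from submetry_imp_array_tree_comparison[OF assms(1) f tree this]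
  obtain b :: "nat \<Rightarrow> 'h" where
    b: "\<And>i j. i \<in> V \<Longrightarrow> j \<in> V \<Longrightarrow> mdist Y (g (a i)) (g (a j)) \<le> dist (b i) (b j)"
      "\<And>i j. (i, j) \<in> E \<Longrightarrow> dist (b i) (b j) = mdist Y (g (a i)) (g (a j))"
    unfolding array_tree_comparison_def by force
  have "E \<subseteq> V \<times> V"
    using tree by (simp add: finite_tree_def)
  have eq: "mdist Y (g (a i)) (g (a j)) = mdist X (a i) (a j)" if "i \<in> V" "j \<in> V" for i j
    using a that by (intro g(2)) auto
  show "array_tree_comparison TYPE('h) V E X a"
    unfolding array_tree_comparison_def
    using b eq \<open>E \<subseteq> V \<times> V\<close> by (intro exI[of _ b]) fastforce
qed

section \<open>Submetries as closures of infinite tree arrays\<close>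

text \<open>For each \<open>n\<close>, the combinations of the first \<open>n\<close> vectors are a continuous image of the
  second-countable space of all real sequences, hence have a countable dense subset.\<close>

lemma separable_hilbert_subspace_closure_span:
  fixes b :: "nat \<Rightarrow> 's::{real_inner, complete_space}"
  shows "separable_hilbert_subspace (closure (span (range b)))"
  unfolding separable_hilbert_subspace_def
proof (intro conjI)
  let ?L = "closure (span (range b))"
  show "subspace ?L"
    unfolding subspace_def
  proof (intro conjI allI ballI)
    show "0 \<in> ?L"
      using closure_subset span_zero by blast
    fix v w and t :: real
    assume "v \<in> ?L"
    then obtain f where f: "\<And>n. f n \<in> span (range b)" "f \<longlonglongrightarrow> v"
      by (auto simp: closure_sequential)
    then have "(\<lambda>n. t *\<^sub>R f n) \<longlonglongrightarrow> t *\<^sub>R v"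
      by (intro tendsto_intros)
    then show "t *\<^sub>R v \<in> ?L"
      unfolding closure_sequential
      by (intro exI[of _ "\<lambda>n. t *\<^sub>R f n"]) (simp add: span_scale f(1))
    assume "w \<in> ?L"
    then obtain g where g: "\<And>n. g n \<in> span (range b)" "g \<longlonglongrightarrow> w"
      by (auto simp: closure_sequential)
    have "(\<lambda>n. f n + g n) \<longlonglongrightarrow> v + w"
      using f(2) g(2) by (rule tendsto_add)
    then show "v + w \<in> ?L"
      unfolding closure_sequential
      by (intro exI[of _ "\<lambda>n. f n + g n"]) (simp add: span_add f(1) g(1))
  qed
  show "complete ?L"
    by (simp add: complete_eq_closed)
  obtain D :: "(nat \<Rightarrow> real) set"
    where D: "countable D" "\<And>U. open U \<Longrightarrow> U \<noteq> {} \<Longrightarrow> \<exists>d\<in>D. d \<in> U"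
    using countable_dense_setE by metis
  define g where "g n c = (\<Sum>i<n. c i *\<^sub>R b i)" for n and c :: "nat \<Rightarrow> real"
  define Q where "Q = (\<Union>n. g n ` D)"
  have gspan: "g n c \<in> span (range b)" for n c
    unfolding g_def by (intro span_sum span_scale span_base) auto
  have "closure D = UNIV"
  proof -
    have "- closure D = {}"
      using D(2)[of "- closure D"] closure_subset[of D] by blast
    then show ?thesis by blast
  qed
  have gQ: "g n c \<in> closure Q" for n c
  proof -
    have "continuous_on UNIV (g n)"
      using continuous_map_span_sum[of "{..<n}" b "range b"]
      by (simp add: g_def continuous_map_in_subtopology flip: continuous_map_iff_continuous2)
    then have "g n ` closure D \<subseteq> closure Q"
      using \<open>closure D = UNIV\<close>
      by (intro image_closure_subset) (auto simp: Q_def intro!: subsetD[OF closure_subset])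
    with \<open>closure D = UNIV\<close> show ?thesis by blast
  qed
  have "span (range b) \<subseteq> closure Q"
  proof
    fix v assume "v \<in> span (range b)"
    then have "\<exists>n c. v = g n c"
    proof (induction rule: span_induct_alt)
      case base
      have "0 = g 0 (\<lambda>_. 0)" by (simp add: g_def)
      then show ?case by blast
    next
      case (step t u v)
      then obtain k n c where u: "u = b k" and v: "v = g n c" by blast
      define c' where "c' i = (if i < n then c i else 0) + (if i = k then t else 0)" for i
      have "g (max n (Suc k)) c' = (\<Sum>i<max n (Suc k). (if i < n then c i *\<^sub>R b i else 0))
          + (\<Sum>i<max n (Suc k). (if i = k then t *\<^sub>R b i else 0))"
        unfolding g_def c'_def sum.distrib[symmetric]
        by (rule sum.cong) (auto simp: scaleR_add_left)
      also have "(\<Sum>i<max n (Suc k). (if i < n then c i *\<^sub>R b i else 0)) = v"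
        unfolding v g_def by (rule sum.mono_neutral_cong_right) auto
      also have "(\<Sum>i<max n (Suc k). (if i = k then t *\<^sub>R b i else 0)) = t *\<^sub>R u"
        using less_max_iff_disj[of k n "Suc k"] by (simp add: u)
      finally show ?case
        by (metis add.commute)
    qed
    then show "v \<in> closure Q"
      using gQ by blast
  qed
  then have "?L \<subseteq> closure Q"
    by (simp add: closure_minimal)
  moreover have "Q \<subseteq> ?L"
    using gspan closure_subset by (fastforce simp: Q_def)
  moreover have "countable Q"
    using D(1) by (auto simp: Q_def)
  ultimately show "separable_space (top_of_set ?L)"
    unfolding separable_space_def
    by (intro exI[of _ Q]) (auto simp: closure_of_subtopology Int_absorb1)
qed

text \<open>The step sizes sum to \<open>2 * c\<close>; the explicit bound on the distance to the limit is what keeps a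
  lift inside the prescribed ball.\<close>

lemma geometric_steps_converge:
  fixes u :: "nat \<Rightarrow> 'a::complete_space"
  assumes step: "\<And>n. dist (u n) (u (Suc n)) \<le> c * (1/2) ^ n"
  obtains l where "u \<longlonglongrightarrow> l" "dist (u 0) l \<le> 2 * c"
proof -
  have tail: "dist (u n) (u (n + k)) \<le> 2 * c * (1/2) ^ n - 2 * c * (1/2) ^ (n + k)" for n k
  proof (induction k)
    case (Suc k)
    have "dist (u n) (u (n + Suc k)) \<le> dist (u n) (u (n + k)) + dist (u (n + k)) (u (Suc (n + k)))"
      using dist_triangle[of "u n" "u (n + Suc k)" "u (n + k)"] by simp
    also have "\<dots> \<le> (2 * c * (1/2) ^ n - 2 * c * (1/2) ^ (n + k)) + c * (1/2) ^ (n + k)"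
      using Suc step[of "n + k"] by (rule add_mono)
    finally show ?case
      by simp
  qed simp
  have "0 \<le> c"
    using order_trans[OF zero_le_dist step[of 0]] by simp
  then have tail': "dist (u n) (u (n + k)) \<le> 2 * c * (1/2) ^ n" for n k
    using tail[of n k] by (smt (verit) mult_nonneg_nonneg zero_le_power divide_nonneg_nonneg)
  have "Cauchy u"
  proof (rule metric_CauchyI)
    fix \<epsilon> :: real assume "0 < \<epsilon>"
    have "(\<lambda>n. 2 * (2 * c * (1/2) ^ n)) \<longlonglongrightarrow> 2 * (2 * c * 0)"
      by (intro tendsto_intros LIMSEQ_power_zero) simp
    then have "\<forall>\<^sub>F n in sequentially. 2 * (2 * c * (1/2) ^ n) < \<epsilon>"
      using \<open>0 < \<epsilon>\<close> by (intro order_tendstoD(2)[of _ 0]) simp_all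
    then obtain N where N: "2 * (2 * c * (1/2) ^ N) < \<epsilon>"
      by (auto simp: eventually_sequentially)
    have near: "dist (u N) (u m) \<le> 2 * c * (1/2) ^ N" if "N \<le> m" for m
      using tail'[of N "m - N"] that by simp
    have "dist (u m) (u n) < \<epsilon>" if "N \<le> m" "N \<le> n" for m n
      using near[OF that(1)] near[OF that(2)] N dist_triangle3[of "u m" "u n" "u N"] by linarith
    then show "\<exists>M. \<forall>m\<ge>M. \<forall>n\<ge>M. dist (u m) (u n) < \<epsilon>"
      by blast
  qed
  then obtain l where l: "u \<longlonglongrightarrow> l"
    by (auto simp: Cauchy_convergent_iff convergent_def)
  have "dist (u 0) l \<le> 2 * c"
  proof (rule LIMSEQ_le_const2[OF tendsto_dist[OF tendsto_const l]])
    show "\<exists>N. \<forall>n\<ge>N. dist (u 0) (u n) \<le> 2 * c"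
      using tail'[of 0] by auto
  qed
  with l show thesis by (rule that)
qed

text \<open>The closure of the set of pairs \<open>(a v, b v)\<close>, taken in \<open>mspace X\<close> times the space of \<open>b\<close>.\<close>

definition limit_pair :: "'a metric \<Rightarrow> (nat \<Rightarrow> 'a) \<Rightarrow> (nat \<Rightarrow> 's::metric_space) \<Rightarrow> 'a \<Rightarrow> 's \<Rightarrow> bool" where
  "limit_pair X a b x w \<longleftrightarrow>
     x \<in> mspace X \<and> (\<forall>\<epsilon>>0. \<exists>v. mdist X (a v) x < \<epsilon> \<and> dist (b v) w < \<epsilon>)"

text \<open>The infinite tree enters only through its labels \<open>a\<close> and the downward edges given by \<open>child\<close>; that
  every label \<open>q l\<close> is available below every vertex is what makes the closure of the array liftable.\<close>

locale tree_array =
  fixes X :: "'a metric" and q a :: "nat \<Rightarrow> 'a" and b :: "nat \<Rightarrow> 's::{real_inner, complete_space}"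
    and child :: "nat \<Rightarrow> nat \<Rightarrow> nat"
  assumes a_in: "\<And>v. a v \<in> mspace X"
    and q_dense: "\<And>x \<epsilon>. x \<in> mspace X \<Longrightarrow> 0 < \<epsilon> \<Longrightarrow> \<exists>l. mdist X (q l) x < \<epsilon>"
    and a_child: "\<And>v l. a (child v l) = q l"
    and noncontracting: "\<And>u v. mdist X (a u) (a v) \<le> dist (b u) (b v)"
    and child_dist: "\<And>v l. dist (b v) (b (child v l)) = mdist X (a v) (a (child v l))"
begin

lemma limit_pair_short:
  assumes "limit_pair X a b x w" "limit_pair X a b y z"
  shows "mdist X x y \<le> dist w z"
proof (rule field_le_epsilon)
  fix \<epsilon> :: real assume "0 < \<epsilon>"
  then obtain u v where u: "mdist X (a u) x < \<epsilon> / 4" "dist (b u) w < \<epsilon> / 4"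
    and v: "mdist X (a v) y < \<epsilon> / 4" "dist (b v) z < \<epsilon> / 4"
    using assms unfolding limit_pair_def by (meson divide_pos_pos zero_less_numeral)
  have x: "x \<in> mspace X" and y: "y \<in> mspace X"
    using assms by (auto simp: limit_pair_def)
  have "mdist X x y \<le> mdist X x (a u) + (mdist X (a u) (a v) + mdist X (a v) y)"
    using mdist_triangle[OF x a_in y, of u] mdist_triangle[OF a_in a_in y, of u v] by linarith
  moreover have "dist (b u) (b v) \<le> dist (b u) w + (dist w z + dist z (b v))"
    using dist_triangle[of "b u" "b v" w] dist_triangle[of w "b v" z] by linarith
  ultimately show "mdist X x y \<le> dist w z + \<epsilon>"
    using u v noncontracting[of u v] by (simp add: mdist_commute[of X x] dist_commute[of z])
qed

lemma limit_pair_unique: "limit_pair X a b x w \<Longrightarrow> limit_pair X a b y w \<Longrightarrow> x = y"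
  using limit_pair_short[of x w y w] mdist_nonneg[of X x y] mdist_zero[of x X y]
  by (simp add: limit_pair_def order_antisym_conv)

text \<open>Start at a vertex \<open>v0\<close> whose pair is close to \<open>(x, w)\<close>, step to a child whose label is within
  \<open>\<delta>\<close> of \<open>y\<close>, and continue with children whose labels approach \<open>y\<close> geometrically. The points of \<open>b\<close>
  move by exactly the distances of consecutive labels, so they converge, and the first
  step, of length about \<open>mdist X x y\<close>, accounts for nearly the whole distance.\<close>

lemma limit_pair_lift:
  assumes xw: "limit_pair X a b x w" and y: "y \<in> mspace X" and "mdist X x y < r"
  shows "\<exists>w'. limit_pair X a b y w' \<and> dist w w' < r"
proof -
  \<comment> \<open>The errors add up to at most \<open>7 * \<delta>\<close>: one to reach \<open>b v0\<close>, two in the first step, four later.\<close>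
  define \<delta> where "\<delta> = (r - mdist X x y) / 8"
  have "0 < \<delta>"
    using assms(3) by (simp add: \<delta>_def)
  have x: "x \<in> mspace X"
    using xw by (simp add: limit_pair_def)
  obtain v0 where v0: "mdist X (a v0) x < \<delta>" "dist (b v0) w < \<delta>"
    using xw \<open>0 < \<delta>\<close> unfolding limit_pair_def by blast
  have "\<exists>l. mdist X (q l) y < \<delta> * (1/2) ^ n" for n
    by (rule q_dense[OF y]) (simp add: \<open>0 < \<delta>\<close>)
  then obtain l where l: "\<And>n. mdist X (q (l n)) y < \<delta> * (1/2) ^ n"
    by metis
  define v where "v = rec_nat v0 (\<lambda>n u. child u (l n))"
  have v_0: "v 0 = v0" and v_Suc: "v (Suc n) = child (v n) (l n)" for n
    by (simp_all add: v_def)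
  have av: "a (v (Suc n)) = q (l n)" for n
    by (simp add: v_Suc a_child)
  have near: "mdist X (a (v (Suc n))) y < \<delta> * (1/2) ^ n" for n
    using l by (simp add: av)
  define u where "u n = b (v (Suc n))" for n
  have "dist (u n) (u (Suc n)) \<le> 2 * \<delta> * (1/2) ^ n" for n
  proof -
    have "dist (u n) (u (Suc n)) = mdist X (a (v (Suc n))) (a (v (Suc (Suc n))))"
      unfolding u_def v_Suc[of "Suc n"] by (rule child_dist)
    also have "\<dots> \<le> mdist X (a (v (Suc n))) y + mdist X (a (v (Suc (Suc n)))) y"
      using mdist_triangle[OF a_in y a_in, of "v (Suc n)" "v (Suc (Suc n))"]
      by (simp add: mdist_commute[of X y])
    also have "\<dots> \<le> \<delta> * (1/2) ^ n + \<delta> * (1/2) ^ Suc n"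
      using near by (intro add_mono less_imp_le)
    also have "\<dots> \<le> 2 * \<delta> * (1/2) ^ n"
      using \<open>0 < \<delta>\<close> by simp
    finally show ?thesis .
  qed
  then obtain w' where w': "u \<longlonglongrightarrow> w'" "dist (u 0) w' \<le> 2 * (2 * \<delta>)"
    using geometric_steps_converge[of u "2 * \<delta>"] by blast
  have "limit_pair X a b y w'"
    unfolding limit_pair_def
  proof (intro conjI allI impI y)
    fix \<epsilon> :: real assume "0 < \<epsilon>"
    have "(\<lambda>n. \<delta> * (1/2) ^ n) \<longlonglongrightarrow> \<delta> * 0"
      by (intro tendsto_intros LIMSEQ_power_zero) simp
    then have "\<forall>\<^sub>F n in sequentially. \<delta> * (1/2) ^ n < \<epsilon>"
      using \<open>0 < \<epsilon>\<close> by (intro order_tendstoD(2)[of _ 0]) simp_all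
    moreover have "\<forall>\<^sub>F n in sequentially. dist (u n) w' < \<epsilon>"
      using w'(1) \<open>0 < \<epsilon>\<close> by (rule tendstoD)
    ultimately have "\<forall>\<^sub>F n in sequentially. \<delta> * (1/2) ^ n < \<epsilon> \<and> dist (u n) w' < \<epsilon>"
      by (rule eventually_conj)
    then obtain n where "\<delta> * (1/2) ^ n < \<epsilon>" "dist (u n) w' < \<epsilon>"
      using eventually_happens'[OF sequentially_bot] by blast
    then show "\<exists>v. mdist X (a v) y < \<epsilon> \<and> dist (b v) w' < \<epsilon>"
      using near[of n] by (intro exI[of _ "v (Suc n)"]) (simp add: u_def)
  qed
  moreover have "dist w w' < r"
  proof -
    have "dist (b v0) (u 0) = mdist X (a v0) (a (v (Suc 0)))"
      unfolding u_def v_Suc v_0 by (rule child_dist)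
    also have "\<dots> \<le> mdist X (a v0) x + (mdist X x y + mdist X (a (v (Suc 0))) y)"
      using mdist_triangle[OF a_in x a_in, of v0 "v (Suc 0)"] mdist_triangle[OF x y a_in, of "v (Suc 0)"]
      by (simp add: mdist_commute[of X y])
    finally have "dist (b v0) (u 0) < mdist X x y + 2 * \<delta>"
      using v0(1) near[of 0] by simp
    moreover have "dist w w' \<le> dist (b v0) w + (dist (b v0) (u 0) + dist (u 0) w')"
      using dist_triangle3[of w w' "b v0"] dist_triangle[of "b v0" w' "u 0"] by linarith
    ultimately have "dist w w' < mdist X x y + 8 * \<delta>"
      using v0(2) w'(2) \<open>0 < \<delta>\<close> by linarith
    moreover have "8 * \<delta> = r - mdist X x y"
      by (simp add: \<delta>_def)
    ultimately show ?thesis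
      by linarith
  qed
  ultimately show ?thesis
    by blast
qed

text \<open>The closed relation \<open>limit_pair\<close> is the graph of a map from part of the Hilbert space, by
  \<open>limit_pair_unique\<close>; shortness and lifting give the two inclusions between balls.\<close>

lemma tree_array_submetry_target: "isometric_to_submetry_target TYPE('s) X"
proof -
  define S where "S = {w. \<exists>x. limit_pair X a b x w}"
  define f where "f w = (THE x. limit_pair X a b x w)" for w
  have f: "f w = x" if "limit_pair X a b x w" for w x
    unfolding f_def using that by (rule the_equality) (rule limit_pair_unique[OF _ that])
  have S: "limit_pair X a b (f w) w" if "w \<in> S" for w
    using that f by (auto simp: S_def)
  then have f_in: "f w \<in> mspace X" if "w \<in> S" for w
    using that by (auto simp: limit_pair_def)
  have lift: "\<exists>w'\<in>S. f w' = y \<and> dist w w' < r"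
    if "w \<in> S" "y \<in> mspace X" "mdist X (f w) y < r" for w y r
    using limit_pair_lift[OF S[OF that(1)] that(2,3)] f by (auto simp: S_def)
  have zero: "mdist X (a 0) (a 0) = 0"
    using a_in[of 0] by simp
  have "mdist X (a 0) (a 0) < \<epsilon> \<and> dist (b 0) (b 0) < \<epsilon>" if "0 < \<epsilon>" for \<epsilon>
    unfolding zero using that by simp
  then have "limit_pair X a b (a 0) (b 0)"
    unfolding limit_pair_def using a_in[of 0] by blast
  then have "b 0 \<in> S"
    by (auto simp: S_def)
  have "f ` S = mspace X"
  proof (intro equalityI subsetI)
    fix y assume "y \<in> mspace X"
    then show "y \<in> f ` S"
      using lift[OF \<open>b 0 \<in> S\<close>, of y "mdist X (f (b 0)) y + 1"] by auto
  qed (use f_in in auto)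
  moreover have "f ` mball_of (submetric euclidean_metric S) w r = mball_of X (f w) r"
    if "w \<in> S" for w r
  proof (intro equalityI subsetI)
    fix y assume "y \<in> f ` mball_of (submetric euclidean_metric S) w r"
    then obtain w' where "w' \<in> S" "dist w w' < r" "y = f w'"
      by auto
    then show "y \<in> mball_of X (f w) r"
      using f_in \<open>w \<in> S\<close> limit_pair_short[OF S S, of w w'] by auto
  next
    fix y assume "y \<in> mball_of X (f w) r"
    then show "y \<in> f ` mball_of (submetric euclidean_metric S) w r"
      using lift[OF \<open>w \<in> S\<close>, of y r] \<open>w \<in> S\<close> by auto
  qed
  ultimately have "submetry (submetric euclidean_metric S) X f"
    by (simp add: submetry_def)
  moreover have "S \<subseteq> closure (span (range b))"
  proof
    fix w assume "w \<in> S"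
    then have "\<exists>v. dist (b v) w < \<epsilon>" if "0 < \<epsilon>" for \<epsilon>
      using S that unfolding limit_pair_def by blast
    then show "w \<in> closure (span (range b))"
      unfolding closure_approachable by (meson rangeI span_base)
  qed
  moreover have "isometric_spaces X X"
    unfolding isometric_spaces_def by (intro exI[of _ id]) simp
  ultimately show ?thesis
    unfolding isometric_to_submetry_target_def
    using separable_hilbert_subspace_closure_span by blast
qed

end

section \<open>The infinite tree with all labels at every vertex\<close>

text \<open>The vertices \<open>0..n\<close> span a finite subtree, because parents precede their children. The arrays
  of these subtrees, translated so that the root is the origin, are bounded at each vertex \<open>i\<close>
  by the total length \<open>R i\<close> of the edges from the vertices \<open>1..i\<close> to their parents. These contain the
  path from \<open>i\<close> to the root, and the bound is the same for all subtrees.\<close>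

lemma all_tree_comparisons_imp_tree_array:
  assumes inf: "infinite_dimensional TYPE('s::real_inner)"
    and cmp: "all_tree_comparisons TYPE('h::real_inner) X"
    and par: "\<And>j. j > 0 \<Longrightarrow> par j < j" and a: "\<And>j. a j \<in> mspace X"
  obtains b :: "nat \<Rightarrow> 's::real_inner" where "\<And>i j. mdist X (a i) (a j) \<le> dist (b i) (b j)"
    and "\<And>j. j > 0 \<Longrightarrow> dist (b (par j)) (b j) = mdist X (a (par j)) (a j)"
proof -
  have "\<exists>c :: nat \<Rightarrow> 'h. (\<forall>i\<le>n. \<forall>j\<le>n. mdist X (a i) (a j) \<le> dist (c i) (c j))
      \<and> (\<forall>j. 0 < j \<longrightarrow> j \<le> n \<longrightarrow> dist (c (par j)) (c j) = mdist X (a (par j)) (a j))" for n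
  proof -
    have "array_tree_comparison TYPE('h) {..n} (parent_edges par n) X a"
      using cmp finite_tree_parent_edges[of par n] par a
      unfolding all_tree_comparisons_def tree_comparison_def by blast
    then obtain c :: "nat \<Rightarrow> 'h" where
      c: "\<forall>i\<in>{..n}. \<forall>j\<in>{..n}. mdist X (a i) (a j) \<le> dist (c i) (c j)"
      "\<forall>(i, j)\<in>parent_edges par n. dist (c i) (c j) = mdist X (a i) (a j)"
      unfolding array_tree_comparison_def by blast
    have "dist (c (par j)) (c j) = mdist X (a (par j)) (a j)" if "0 < j" "j \<le> n" for j
    proof -
      have "(par j, j) \<in> parent_edges par n"
        using par[OF that(1)] that by (simp add: parent_edges_def)
      from bspec[OF c(2) this] show ?thesis by simp
    qed
    with c(1) show ?thesis
      by (intro exI[of _ c]) simp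
  qed
  then obtain c :: "nat \<Rightarrow> nat \<Rightarrow> 'h" where
    lower: "\<And>n i j. i \<le> n \<Longrightarrow> j \<le> n \<Longrightarrow> mdist X (a i) (a j) \<le> dist (c n i) (c n j)"
    and edge: "\<And>n j. 0 < j \<Longrightarrow> j \<le> n \<Longrightarrow>
      dist (c n (par j)) (c n j) = mdist X (a (par j)) (a j)"
    by metis
  define R where "R i = (\<Sum>j=1..i. mdist X (a (par j)) (a j))" for i
  define x where "x n i = (if i \<le> n then c n i - c n 0 else 0)" for n i
  have x_dist: "dist (x n i) (x n j) = dist (c n i) (c n j)" if "i \<le> n" "j \<le> n" for n i j
    using that by (simp add: x_def dist_norm)
  have "dist (c n i) (c n 0) \<le> R i" if "i \<le> n" for n i
    using that
  proof (induction i rule: less_induct)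
    case (less i)
    show ?case
    proof (cases "i = 0")
      case True
      then show ?thesis by (simp add: R_def)
    next
      case False
      then have "par i < i"
        using par by simp
      have "dist (c n i) (c n 0) \<le> dist (c n (par i)) (c n i) + dist (c n (par i)) (c n 0)"
        by (rule dist_triangle3)
      also have "\<dots> \<le> mdist X (a (par i)) (a i) + R (par i)"
        using less \<open>par i < i\<close> False by (simp add: edge)
      also have "R (par i) \<le> R (i - 1)"
        unfolding R_def using \<open>par i < i\<close> by (intro sum_mono2) auto
      also have "mdist X (a (par i)) (a i) + R (i - 1) = R i"
        using False by (cases i) (auto simp: R_def)
      finally show ?thesis
        by simp
    qed
  qed
  moreover have "0 \<le> R i" for i
    by (simp add: R_def sum_nonneg)
  ultimately have "norm (x n i) \<le> R i" for n i
    by (simp add: x_def dist_norm)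
  then obtain r and b :: "nat \<Rightarrow> 's" where r: "strict_mono r"
    and lim: "\<And>i j. (\<lambda>n. dist (x (r n) i) (x (r n) j)) \<longlonglongrightarrow> dist (b i) (b j)"
    using bounded_arrays_subconverge[OF inf, of x R] by blast
  have large: "k \<le> r n" if "k \<le> n" for k n
    using seq_suble[OF r, of n] that by simp
  have "mdist X (a i) (a j) \<le> dist (b i) (b j)" for i j
  proof (rule LIMSEQ_le_const[OF lim])
    show "\<exists>N. \<forall>n\<ge>N. mdist X (a i) (a j) \<le> dist (x (r n) i) (x (r n) j)"
      by (intro exI[of _ "max i j"]) (auto simp: x_dist large lower)
  qed
  moreover have "dist (b (par j)) (b j) = mdist X (a (par j)) (a j)" if "0 < j" for j
  proof (rule LIMSEQ_unique[OF lim])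
    have "\<forall>n\<ge>j. mdist X (a (par j)) (a j) = dist (x (r n) (par j)) (x (r n) j)"
    proof (intro allI impI)
      fix n assume "j \<le> n"
      then have "j \<le> r n" "par j \<le> r n"
        using large par[OF that] by (meson less_imp_le order_trans)+
      then show "mdist X (a (par j)) (a j) = dist (x (r n) (par j)) (x (r n) j)"
        using that by (simp add: x_dist edge)
    qed
    then show "(\<lambda>n. dist (x (r n) (par j)) (x (r n) j)) \<longlonglongrightarrow> mdist X (a (par j)) (a j)"
      by (intro Lim_transform_eventually[OF tendsto_const] eventually_sequentiallyI[of j]) blast
  qed
  ultimately show thesis
    by (rule that)
qed

lemma separable_metric_dense_sequence:
  assumes "separable_space (mtopology_of X)" "mspace X \<noteq> {}"
  shows "\<exists>q :: nat \<Rightarrow> 'a. (\<forall>n. q n \<in> mspace X) \<and>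
    (\<forall>x\<in>mspace X. \<forall>\<epsilon>>0. \<exists>n. mdist X (q n) x < \<epsilon>)"
proof -
  interpret Metric_space "mspace X" "mdist X"
    by (rule Metric_space_mspace_mdist)
  obtain C where C: "countable C" "C \<subseteq> mspace X" "mtopology closure_of C = mspace X"
    using assms(1) by (auto simp: separable_space_def mtopology_of_def)
  then have dense: "\<exists>c\<in>C. mdist X c x < \<epsilon>" if "x \<in> mspace X" "0 < \<epsilon>" for x \<epsilon>
    using that metric_closure_of[of C] by (fastforce simp: commute)
  have "C \<noteq> {}"
    using dense assms(2) zero_less_one by blast
  then have "range (from_nat_into C) = C"
    using C(1) by (simp add: range_from_nat_into)
  then show ?thesis
    using C(2) dense by (intro exI[of _ "from_nat_into C"]) (metis rangeE rangeI subsetD)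
qed

text \<open>The infinite tree is encoded on the natural numbers: the root is \<open>0\<close>, and the child of \<open>v\<close>
  labeled \<open>q l\<close> is \<open>Suc (prod_encode (v, l))\<close>. The pairing function dominates its first argument, so
  every parent is smaller than its children. The empty space has no label for a root and is the
  target of the empty map.\<close>

lemma all_tree_comparisons_imp_submetry_target:
  fixes X :: "'a metric"
  assumes inf: "infinite_dimensional TYPE('s::{real_inner, complete_space})"
    and sep: "separable_space (mtopology_of X)"
    and cmp: "all_tree_comparisons TYPE('h::real_inner) X"
  shows "isometric_to_submetry_target TYPE('s) X"
proof (cases "mspace X = {}")
  case True
  have "separable_hilbert_subspace (closure (span (range (\<lambda>_ :: nat. 0 :: 's))))"
    by (rule separable_hilbert_subspace_closure_span)
  moreover have "submetry (submetric euclidean_metric ({} :: 's set)) X f" for f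
    using True by (simp add: submetry_def)
  moreover have "isometric_spaces X X"
    unfolding isometric_spaces_def by (intro exI[of _ id]) simp
  ultimately show ?thesis
    unfolding isometric_to_submetry_target_def by blast
next
  case False
  obtain q :: "nat \<Rightarrow> 'a" where q: "\<forall>n. q n \<in> mspace X"
    and dense: "\<forall>x\<in>mspace X. \<forall>\<epsilon>>0. \<exists>n. mdist X (q n) x < \<epsilon>"
    using separable_metric_dense_sequence[OF sep False] by blast
  define child where "child v l = Suc (prod_encode (v, l))" for v l
  define par where "par j = fst (prod_decode (j - 1))" for j
  define a where "a j = q (snd (prod_decode (j - 1)))" for j
  have par: "par j < j" if "0 < j" for j
  proof -
    have "j - 1 = prod_encode (par j, snd (prod_decode (j - 1)))"
      by (simp add: par_def)
    then have "par j \<le> j - 1"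
      using le_prod_encode_1 by metis
    with that show ?thesis by simp
  qed
  have a: "a j \<in> mspace X" for j
    by (simp add: a_def q)
  obtain b :: "nat \<Rightarrow> 's" where b: "\<And>i j. mdist X (a i) (a j) \<le> dist (b i) (b j)"
    "\<And>j. j > 0 \<Longrightarrow> dist (b (par j)) (b j) = mdist X (a (par j)) (a j)"
    using all_tree_comparisons_imp_tree_array[OF inf cmp, of par a, OF par a] by metis
  have "par (child v l) = v" and a_child: "a (child v l) = q l" and "child v l > 0" for v l
    by (simp_all add: par_def a_def child_def)
  then have "dist (b v) (b (child v l)) = mdist X (a v) (a (child v l))" for v l
    using b(2)[of "child v l"] by simp
  then interpret tree_array X q a b child
    by unfold_locales (use a dense a_child b(1) in auto)
  show ?thesis
    by (rule tree_array_submetry_target)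
qed

section \<open>Equivalence of tree comparison and submetry targets\<close>

theorem theorem1p6:
  fixes X :: "'a metric"
  assumes "infinite_dimensional TYPE('h::{real_inner, complete_space})"
    and "infinite_dimensional TYPE('s::{real_inner, complete_space})"
    and "separable_space (mtopology_of X)"
  shows "all_tree_comparisons TYPE('h) X \<longleftrightarrow> isometric_to_submetry_target TYPE('s) X"
  using all_tree_comparisons_imp_submetry_target[OF assms(2,3)]
    submetry_target_imp_all_tree_comparisons[OF assms(1)]
  by blast

end
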